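(* Let $d$ be a positive integer. Every convex hypersurface $M$ in $\mathbb{R}^d$ is $\gamma$-null, i.e. $\gamma(M)=0$.
   Context: A convex hypersurface in $\mathbb{R}^d$ is (a subset of) the boundary of a convex subset of $\mathbb{R}^d$. $|\cdot|$ denotes the Euclidean norm. The proximal map of a convex function $f:\mathbb{R}^d\to\mathbb{R}$ is $\operatorname{prox}_f(x)=\arg\min_{y\in\mathbb{R}^d}\left(f(y)+\frac{|x-y|^2}{2}\right)$ (the unique minimizer). A function $f:\mathbb{R}^d\to\mathbb{R}$ is polyhedral if it is the maximum of finitely many affine functions. For a polyhedral function $f$, the generalized strip associated to $f$, denoted $S(f)$, is the set of points $x\in\mathbb{R}^d$ such that $f$ is not differentiable at $\operatorname{prox}_f(x)$. A set $S\subseteq\mathbb{R}^d$ is a generalized strip if $S=S(f)$ for some polyhedral $f$; its width is $w(S)=2\inf\{\operatorname{Lip} f : f \text{ polyhedral},\ S=S(f)\}$, where $\operatorname{Lip} f$ is the (best) Lipschitz constant of $f$. The outer measure $\gamma$ on subsets of $\mathbb{R}^d$ is $\gamma(A)=\inf\left\{\sum_{i=1}^\infty w(S_i) : S_1,S_2,\dots \text{ generalized strips with } A\subseteq\bigcup_{i=1}^\infty S_i\right\}$. *)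

theory Defs
  imports "HOL-Analysis.Analysis"
begin

definition convex_hypersurface :: "'a::euclidean_space set \<Rightarrow> bool" where
  "convex_hypersurface M \<longleftrightarrow> (\<exists>C. convex C \<and> M \<subseteq> frontier C)"

(* For convex real-valued f the minimizer exists and is unique, so the choice made by
   arg_min is immaterial. *)
definition prox :: "('a::euclidean_space \<Rightarrow> real) \<Rightarrow> 'a \<Rightarrow> 'a" where
  "prox f x = arg_min (\<lambda>y. f y + (norm (x - y))\<^sup>2 / 2) (\<lambda>y. True)"

(* A pair (a, b) encodes the affine function y \<mapsto> a \<bullet> y + b. *)
definition polyhedral :: "('a::euclidean_space \<Rightarrow> real) \<Rightarrow> bool" where
  "polyhedral f \<longleftrightarrow>
     (\<exists>A :: ('a \<times> real) set. finite A \<and> A \<noteq> {} \<and>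
        (\<forall>x. f x = Max ((\<lambda>(a, b). a \<bullet> x + b) ` A)))"

definition strip :: "('a::euclidean_space \<Rightarrow> real) \<Rightarrow> 'a set" where
  "strip f = {x. \<not> f differentiable (at (prox f x))}"

definition generalized_strip :: "'a::euclidean_space set \<Rightarrow> bool" where
  "generalized_strip S \<longleftrightarrow> (\<exists>f. polyhedral f \<and> S = strip f)"

(* Meaningful for Lipschitz f only (otherwise the set is empty); polyhedral functions are
   Lipschitz. *)
definition Lip :: "('a::euclidean_space \<Rightarrow> real) \<Rightarrow> real" where
  "Lip f = Inf {L. L-lipschitz_on UNIV f}"

(* Only used for generalized strips, where the infimum is over a nonempty set of
   nonnegative reals. *)
definition width :: "'a::euclidean_space set \<Rightarrow> real" where
  "width S = 2 * Inf {Lip f | f. polyhedral f \<and> S = strip f}"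

definition gamma :: "'a::euclidean_space set \<Rightarrow> ennreal" where
  "gamma A = Inf {(\<Sum>i. ennreal (width (S i))) | S :: nat \<Rightarrow> 'a set.
                    (\<forall>i. generalized_strip (S i)) \<and> A \<subseteq> (\<Union>i. S i)}"

end

theory Submission
  imports Defs
begin

text \<open>
  Let \<open>K\<close> be the part of \<open>M\<close> in some ball and \<open>h\<close> its support function. For a finite set \<open>N\<close> of
  unit vectors, let \<open>f y\<close> be the maximum of \<open>0\<close> and of all \<open>e (w \<bullet> y - h w + e/2)\<close> with \<open>w \<in> N\<close>,
  a polyhedral version of \<open>e\<close> times the distance to the convex hull of \<open>K\<close>, pushed inwards by \<open>e/2\<close>.
  If \<open>f\<close> is differentiable at \<open>p = prox f x\<close>, then \<open>x - p\<close> is the slope of any affine piece that is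
  active at \<open>p\<close>. If this slope is \<open>e w\<close>, then \<open>x\<close> lies strictly beyond the supporting hyperplane of
  \<open>K\<close> with normal \<open>w\<close>. If it is \<open>0\<close>, then \<open>x = p\<close> lies at depth at least \<open>e/2\<close> behind all the
  supporting hyperplanes with normals in \<open>N\<close>. Neither happens for \<open>x \<in> K\<close> if \<open>N\<close> is a sufficiently
  fine net of the sphere, since \<open>x\<close> lies on some supporting hyperplane of \<open>K\<close>. So \<open>K\<close> is covered by
  one generalized strip of width at most \<open>2 e\<close>, and \<open>M\<close> by countably many of small total width.
\<close>

section \<open>Maxima of affine functions, Lipschitz constants and widths\<close>

definition max_affine :: "('a::euclidean_space \<times> real) set \<Rightarrow> 'a \<Rightarrow> real" where
  "max_affine A x = Max ((\<lambda>(a, b). a \<bullet> x + b) ` A)"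

lemma polyhedral_iff_max_affine:
  "polyhedral f \<longleftrightarrow> (\<exists>A. finite A \<and> A \<noteq> {} \<and> f = max_affine A)"
  unfolding polyhedral_def max_affine_def fun_eq_iff ..

lemma max_affine_ge:
  assumes "finite A" "(a, b) \<in> A"
  shows "a \<bullet> x + b \<le> max_affine A x"
  unfolding max_affine_def using assms by (intro Max_ge) force+

lemma max_affine_active:
  assumes "finite A" "A \<noteq> {}"
  obtains a b where "(a, b) \<in> A" "max_affine A x = a \<bullet> x + b"
proof -
  have "max_affine A x \<in> (\<lambda>(a, b). a \<bullet> x + b) ` A"
    unfolding max_affine_def using assms by (intro Max_in) auto
  then show ?thesis using that by auto
qed

lemma lipschitz_max_affine:
  assumes "finite A" "A \<noteq> {}" and L: "\<And>a b. (a, b) \<in> A \<Longrightarrow> norm a \<le> L"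
  shows "L-lipschitz_on UNIV (max_affine A)"
proof -
  have "0 \<le> L"
    using assms(2) L norm_ge_zero order_trans by (metis equals0I surj_pair)
  have *: "max_affine A x - max_affine A y \<le> L * dist x y" for x y
  proof -
    obtain a b where ab: "(a, b) \<in> A" "max_affine A x = a \<bullet> x + b"
      using max_affine_active assms(1,2) .
    have "max_affine A x - max_affine A y \<le> a \<bullet> (x - y)"
      using ab max_affine_ge[OF assms(1) ab(1), of y] by (simp add: inner_diff_right)
    also have "\<dots> \<le> norm a * norm (x - y)"
      by (rule norm_cauchy_schwarz)
    also have "\<dots> \<le> L * dist x y"
      using L[OF ab(1)] by (simp add: dist_norm mult_right_mono)
    finally show ?thesis .
  qed
  show ?thesis
    by (rule lipschitz_onI[OF _ \<open>0 \<le> L\<close>])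
      (use *[of _ _] in \<open>force simp: dist_real_def abs_le_iff dist_commute\<close>)
qed

lemma Lip_le:
  assumes "L-lipschitz_on UNIV f"
  shows "Lip f \<le> L"
  unfolding Lip_def
  by (rule cInf_lower) (use assms lipschitz_on_nonneg in \<open>auto intro!: bdd_belowI[of _ 0]\<close>)

lemma Lip_nonneg:
  assumes "polyhedral f"
  shows "0 \<le> Lip f"
proof -
  obtain A where A: "finite A" "A \<noteq> {}" "f = max_affine A"
    using assms polyhedral_iff_max_affine by blast
  \<comment> \<open>The largest slope norm is a Lipschitz constant. One has to be exhibited, since
    the real \<open>Inf\<close> of an empty set is not known to be nonnegative.\<close>
  have "norm a \<le> Max ((norm \<circ> fst) ` A)" if "(a, b) \<in> A" for a b
    using that A by (intro Max_ge) force+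
  then have "\<exists>L. L-lipschitz_on UNIV f"
    using lipschitz_max_affine A by blast
  then show ?thesis
    unfolding Lip_def by (intro cInf_greatest) (auto dest: lipschitz_on_nonneg)
qed

text \<open>\<open>f\<close> itself competes in the infimum, and nonnegativity of \<open>Lip\<close>
  bounds all competitors below.\<close>

lemma width_strip_le:
  assumes "polyhedral f" "L-lipschitz_on UNIV f"
  shows "width (strip f) \<le> 2 * L"
proof -
  have "Inf {Lip g | g. polyhedral g \<and> strip f = strip g} \<le> Lip f"
    using assms(1) Lip_nonneg by (intro cInf_lower) (auto intro!: bdd_belowI[of _ 0])
  then show ?thesis
    unfolding width_def using Lip_le[OF assms(2)] by simp
qed

section \<open>Proximal points and first-order conditions\<close>

lemma prox_minimal:
  fixes f :: "'a::euclidean_space \<Rightarrow> real"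
  assumes "continuous_on UNIV f" and nonneg: "\<And>y. 0 \<le> f y"
  shows "f (prox f x) + (norm (x - prox f x))\<^sup>2 / 2 \<le> f y + (norm (x - y))\<^sup>2 / 2"
proof -
  define g where "g y = f y + (norm (x - y))\<^sup>2 / 2" for y
  \<comment> \<open>Compactness gives a minimizer on this ball. Outside it the quadratic term alone
    is at least \<open>f x\<close>, the value of \<open>g\<close> at the centre.\<close>
  have "continuous_on (cball x (f x + 1)) g"
    unfolding g_def by (intro continuous_intros continuous_on_subset[OF assms(1)]) auto
  moreover have "x \<in> cball x (f x + 1)"
    using nonneg[of x] by simp
  ultimately obtain p where p: "\<And>y. y \<in> cball x (f x + 1) \<Longrightarrow> g p \<le> g y"
    using continuous_attains_inf[of "cball x (f x + 1)" g] by (metis compact_cball empty_iff)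
  have "g p \<le> g y" for y
  proof (cases "y \<in> cball x (f x + 1)")
    case False
    have "2 * f x \<le> (f x + 1)\<^sup>2"
      by (simp add: power2_sum)
    also have "\<dots> \<le> (norm (x - y))\<^sup>2"
      using False nonneg[of x] by (intro power_mono) (auto simp: dist_norm)
    finally have "g x \<le> g y"
      using nonneg[of y] by (simp add: g_def)
    with p[OF \<open>x \<in> cball x (f x + 1)\<close>] show ?thesis by simp
  qed (rule p)
  then have "is_arg_min g (\<lambda>y. True) p"
    by (simp add: is_arg_min_linorder)
  then have "is_arg_min g (\<lambda>y. True) (prox f x)"
    unfolding prox_def g_def[symmetric] arg_min_def by (rule someI)
  then show ?thesis
    by (simp add: is_arg_min_linorder g_def)
qed

text \<open>Two first-order conditions determine the gradient at the proximal point
  \<open>p\<close>: an active piece touches the function from below there, which gives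
  \<open>a\<close>, and minimality of the proximal functional gives \<open>x - p\<close>. The piece
  \<open>(0, 0)\<close> makes the function nonnegative, as \<open>prox_minimal\<close>
  requires.\<close>

lemma slope_eq_of_not_in_strip:
  assumes A: "finite A" "(0, 0) \<in> A" and x: "x \<notin> strip (max_affine A)"
  obtains a b where "(a, b) \<in> A" "x - a = prox (max_affine A) x"
    "max_affine A (prox (max_affine A) x) = a \<bullet> prox (max_affine A) x + b"
proof -
  define f where "f = max_affine A"
  define p where "p = prox f x"
  have "A \<noteq> {}" using A by auto
  then obtain a b where ab: "(a, b) \<in> A" "f p = a \<bullet> p + b"
    using max_affine_active[OF A(1), of p] unfolding f_def by blast
  have "(Max ((norm \<circ> fst) ` A))-lipschitz_on UNIV f"
    unfolding f_def using A \<open>A \<noteq> {}\<close>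
    by (intro lipschitz_max_affine Max_ge) force+
  then have cont: "continuous_on UNIV f"
    by (rule lipschitz_on_continuous_on)
  have nonneg: "0 \<le> f y" for y
    using max_affine_ge[OF A, of y] by (simp add: f_def)
  obtain D where D: "(f has_derivative D) (at p)"
    using x unfolding strip_def differentiable_def f_def p_def by blast
  have "((\<lambda>y. f y - (a \<bullet> y + b)) has_derivative (\<lambda>v. D v - a \<bullet> v)) (at p)"
    by (auto intro!: derivative_eq_intros D)
  then have "(\<lambda>v. D v - a \<bullet> v) = (\<lambda>v. 0)"
    by (rule has_derivative_local_min)
      (use ab max_affine_ge[OF A(1) ab(1)] in \<open>simp add: f_def\<close>)
  then have Da: "D v = a \<bullet> v" for v
    by (metis eq_iff_diff_eq_0)
  have "((\<lambda>y. f y + (norm (x - y))\<^sup>2 / 2) has_derivative (\<lambda>v. D v - (x - p) \<bullet> v)) (at p)"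
    unfolding power2_norm_eq_inner
    by (auto intro!: derivative_eq_intros D simp: inner_commute)
  then have "(\<lambda>v. D v - (x - p) \<bullet> v) = (\<lambda>v. 0)"
    by (rule has_derivative_local_min)
      (use prox_minimal[OF cont nonneg] in \<open>simp add: p_def\<close>)
  then have "a \<bullet> v = (x - p) \<bullet> v" for v
    by (metis Da eq_iff_diff_eq_0)
  then have "a = x - p"
    by (metis vector_eq_rdot)
  then show ?thesis
    using that ab unfolding f_def p_def by simp
qed

section \<open>Covering a bounded supported set by one strip\<close>

lemma sphere_net:
  fixes x :: "'a::euclidean_space"
  assumes "0 < e"
  obtains N where "finite N" "N \<subseteq> sphere (0::'a) 1"
    "\<And>u. norm u = 1 \<Longrightarrow> \<exists>w\<in>N. norm (u - w) < e"
proof -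
  obtain N where N: "finite N" "N \<subseteq> sphere (0::'a) 1" "sphere 0 1 \<subseteq> (\<Union>w\<in>N. ball w e)"
    using seq_compact_imp_totally_bounded[of "sphere (0::'a) 1"] assms
    by (metis compact_imp_seq_compact compact_sphere)
  show ?thesis
  proof (rule that[OF N(1,2)])
    fix u :: 'a assume "norm u = 1"
    then have "u \<in> (\<Union>w\<in>N. ball w e)"
      using N(3) by (simp add: subset_iff)
    then show "\<exists>w\<in>N. norm (u - w) < e"
      by (auto simp: dist_norm norm_minus_commute)
  qed
qed

lemma supported_bounded_set_subset_strip:
  fixes K :: "'a::euclidean_space set"
  assumes e: "0 < e" and R: "\<And>x. x \<in> K \<Longrightarrow> norm x \<le> R"
    and supp: "\<And>x. x \<in> K \<Longrightarrow> \<exists>u. norm u = 1 \<and> (\<forall>y\<in>K. u \<bullet> y \<le> u \<bullet> x)"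
  obtains f where "polyhedral f" "e-lipschitz_on UNIV f" "K \<subseteq> strip f"
proof -
  define R' where "R' = max R 1"
  have R': "0 < R'" "\<And>x. x \<in> K \<Longrightarrow> norm x \<le> R'"
    using R by (auto simp: R'_def max.coboundedI1)
  \<comment> \<open>With this mesh, replacing a normal by a nearby net point changes its inner
    product with a point of \<open>K\<close> by at most \<open>e / 8\<close>; case 1 does so at both
    \<open>x\<close> and \<open>y\<close>.\<close>
  define \<eta> where "\<eta> = e / (8 * R')"
  have \<eta>: "0 < \<eta>" "\<eta> * R' = e / 8"
    using e R' by (auto simp: \<eta>_def)
  obtain N where N: "finite N" "N \<subseteq> sphere (0::'a) 1"
      "\<And>u. norm u = 1 \<Longrightarrow> \<exists>w\<in>N. norm (u - w) < \<eta>"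
    using sphere_net[OF \<eta>(1)] by blast
  define h where "h w = (SUP y\<in>K. w \<bullet> y)" for w
  have bdd: "bdd_above ((\<lambda>y. w \<bullet> y) ` K)" for w
  proof (rule bdd_aboveI2)
    fix y assume "y \<in> K"
    have "w \<bullet> y \<le> norm w * norm y" by (rule norm_cauchy_schwarz)
    also have "\<dots> \<le> norm w * R'" using R'(2)[OF \<open>y \<in> K\<close>] by (simp add: mult_left_mono)
    finally show "w \<bullet> y \<le> norm w * R'" .
  qed
  have h_ge: "w \<bullet> y \<le> h w" if "y \<in> K" for w y
    unfolding h_def using that bdd by (rule cSUP_upper)
  \<comment> \<open>The inward shift \<open>e / 2\<close> lies strictly between the net error
    \<open>e / 4\<close>, which decides case 1, and the displacement \<open>e\<close> from
    \<open>p\<close> to \<open>x\<close>, which decides case 2.\<close>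
  define A where "A = insert (0, 0) ((\<lambda>w. (e *\<^sub>R w, e * (e / 2 - h w))) ` N)"
  have A: "finite A" "A \<noteq> {}" "(0, 0) \<in> A"
    using N by (auto simp: A_def)
  have "e-lipschitz_on UNIV (max_affine A)"
    using N(2) e by (intro lipschitz_max_affine A) (auto simp: A_def)
  moreover have "polyhedral (max_affine A)"
    using A polyhedral_iff_max_affine by blast
  moreover have "K \<subseteq> strip (max_affine A)"
  proof (rule subsetI, rule ccontr)
    fix x assume xK: "x \<in> K" and "x \<notin> strip (max_affine A)"
    then obtain a b p where ab: "(a, b) \<in> A" and p: "x - a = p"
        and val: "max_affine A p = a \<bullet> p + b"
      using slope_eq_of_not_in_strip[OF A(1,3)] by metis
    from ab consider "a = 0" "b = 0" | w where "w \<in> N" "a = e *\<^sub>R w" "b = e * (e / 2 - h w)"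
      unfolding A_def by auto
    then show False
    proof cases
      case 1
      obtain u where u: "norm u = 1" "\<And>y. y \<in> K \<Longrightarrow> u \<bullet> y \<le> u \<bullet> x"
        using supp[OF xK] by blast
      obtain w where w: "w \<in> N" "norm (u - w) < \<eta>"
        using N(3) u(1) by blast
      have close: "\<bar>(u - w) \<bullet> y\<bar> \<le> e / 8" if "y \<in> K" for y
      proof -
        have "\<bar>(u - w) \<bullet> y\<bar> \<le> norm (u - w) * norm y"
          by (rule Cauchy_Schwarz_ineq2)
        also have "\<dots> \<le> \<eta> * R'"
          using w R'(2)[OF that] \<eta> by (intro mult_mono) auto
        finally show ?thesis by (simp add: \<eta>)
      qed
      have "h w \<le> w \<bullet> x + e / 4"
        unfolding h_def
      proof (rule cSUP_least)
        fix y assume y: "y \<in> K"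
        show "w \<bullet> y \<le> w \<bullet> x + e / 4"
          using close[OF y] close[OF xK] u(2)[OF y]
            unfolding inner_diff_left by linarith
      qed (use xK in auto)
      have "(e *\<^sub>R w, e * (e / 2 - h w)) \<in> A"
        using w by (auto simp: A_def)
      from max_affine_ge[OF A(1) this, of p] have "e * (w \<bullet> x + e / 2 - h w) \<le> 0"
        using val p 1 by (simp add: algebra_simps)
      with e have "w \<bullet> x + e / 2 - h w \<le> 0"
        by (simp add: mult_le_0_iff)
      with \<open>h w \<le> w \<bullet> x + e / 4\<close> e show False by simp
    next
      case 2
      have "w \<bullet> w = 1"
        using N(2) \<open>w \<in> N\<close> by (auto simp: norm_eq_1)
      have "0 \<le> e * (w \<bullet> p + e / 2 - h w)"
        using max_affine_ge[OF A(1,3), of p] val 2 by (simp add: algebra_simps)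
      with e have "0 \<le> w \<bullet> p + e / 2 - h w"
        by (simp add: zero_le_mult_iff)
      also have "w \<bullet> p = w \<bullet> x - e"
        using p[symmetric] 2 \<open>w \<bullet> w = 1\<close> by (simp add: inner_diff_right)
      finally show False
        using h_ge[OF xK, of w] e by simp
    qed
  qed
  ultimately show ?thesis using that by blast
qed

section \<open>Supporting hyperplanes and the countable cover\<close>

lemma frontier_convex_supported:
  fixes C :: "'a::euclidean_space set"
  assumes "convex C" "x \<in> frontier C"
  shows "\<exists>u. norm u = 1 \<and> (\<forall>y\<in>frontier C. u \<bullet> y \<le> u \<bullet> x)"
proof -
  have x: "x \<in> closure C" "x \<notin> interior C"
    using assms by (auto simp: frontier_def)
  \<comment> \<open>If the interior is empty, \<open>C\<close> lies in a hyperplane, whose normal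
    serves at every point. Otherwise \<open>x\<close> is outside the relative interior and the
    supporting hyperplane theorem applies.\<close>
  obtain a where a: "a \<noteq> 0" "\<And>y. y \<in> closure C \<Longrightarrow> a \<bullet> x \<le> a \<bullet> y"
  proof (cases "interior C = {}")
    case True
    then obtain a b where "a \<noteq> 0" "C \<subseteq> {y. a \<bullet> y = b}"
      using empty_interior_subset_hyperplane assms(1) by metis
    moreover from this have "closure C \<subseteq> {y. a \<bullet> y = b}"
      by (simp add: closure_minimal closed_hyperplane)
    ultimately show ?thesis
      using that[of a] x(1) by (metis (mono_tags) mem_Collect_eq order_refl subsetD)
  next
    case False
    then have "x \<notin> rel_interior C"
      using x(2) by (simp add: rel_interior_nonempty_interior)
    then show ?thesis
      using supporting_hyperplane_relative_frontier[OF assms(1) x(1)] that by metis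
  qed
  define u where "u = - (a /\<^sub>R norm a)"
  have "u \<bullet> y \<le> u \<bullet> x" if "y \<in> frontier C" for y
    using a(2)[of y] a(1) that by (simp add: u_def frontier_def divide_right_mono mult_left_mono)
  moreover have "norm u = 1"
    using a(1) by (simp add: u_def)
  ultimately show ?thesis by blast
qed

lemma gamma_convex_hypersurface_le:
  assumes "convex_hypersurface M" and e: "0 < (e::real)"
  shows "gamma M \<le> ennreal e"
proof -
  obtain C where C: "convex C" "M \<subseteq> frontier C"
    using assms(1) unfolding convex_hypersurface_def by blast
  \<comment> \<open>Widths are at most \<open>2 * \<delta> n\<close>, a geometric series with sum
    \<open>e\<close>.\<close>
  define \<delta> where "\<delta> n = e / 2 * (1 / 2) ^ Suc n" for n :: nat
  have \<delta>: "0 < \<delta> n" for n using e by (simp add: \<delta>_def)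
  have "\<exists>f. polyhedral f \<and> (\<delta> n)-lipschitz_on UNIV f \<and> M \<inter> cball 0 (real n) \<subseteq> strip f" for n
  proof -
    \<comment> \<open>A hyperplane supporting the whole frontier at \<open>x\<close> also supports
      every subset containing \<open>x\<close>.\<close>
    have "\<exists>u. norm u = 1 \<and> (\<forall>y\<in>M \<inter> cball 0 (real n). u \<bullet> y \<le> u \<bullet> x)"
      if "x \<in> M \<inter> cball 0 (real n)" for x
      using frontier_convex_supported[OF C(1), of x] C(2) that by blast
    then show ?thesis
      using supported_bounded_set_subset_strip[OF \<delta>, of "M \<inter> cball 0 (real n)" "real n" n]
      by (metis Int_iff mem_cball_0)
  qed
  then obtain f where f: "\<And>n. polyhedral (f n)" "\<And>n. (\<delta> n)-lipschitz_on UNIV (f n)"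
      "\<And>n. M \<inter> cball 0 (real n) \<subseteq> strip (f n)"
    by metis
  have "M \<subseteq> (\<Union>n. strip (f n))"
  proof
    fix x assume "x \<in> M"
    moreover obtain n where "norm x \<le> real n" using real_arch_simple by blast
    ultimately show "x \<in> (\<Union>n. strip (f n))" using f(3)[of n] by auto
  qed
  then have "gamma M \<le> (\<Sum>n. ennreal (width (strip (f n))))"
    unfolding gamma_def generalized_strip_def using f(1)
    by (intro Inf_lower CollectI exI[of _ "\<lambda>n. strip (f n)"]) blast
  also have "\<dots> \<le> (\<Sum>n. ennreal (e * (1 / 2) ^ Suc n))"
    using width_strip_le[OF f(1,2)]
    by (intro suminf_le ennreal_leI) (auto simp: \<delta>_def)
  also have "\<dots> = ennreal e"
    using sums_mult[OF power_half_series, of e] e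
    by (intro suminf_ennreal_eq) auto
  finally show ?thesis .
qed

theorem theorem4p2:
  fixes M :: "(real ^ 'd) set"
  assumes "convex_hypersurface M"
  shows "gamma M = 0"
  using gamma_convex_hypersurface_le[OF assms]
  by (metis ennreal_0 ennreal_le_epsilon add_0 le_zero_eq)

end
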